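(* Let $A\subset\mathbb{R}^n$ be a set of points (not necessarily finite), let $a\mapsto w_a$ be a real-valued function on $A$, and let $\sigma=[a_0a_1\ldots a_p]$, $p\ge0$, be a simplex with vertices in $A$. Then: (1) $\sigma$ has a weighted strong witness in $\mathbb{R}^n$ with respect to $A$ if and only if every subsimplex $\tau\le\sigma$ (including the $0$-dimensional ones) has a weighted weak witness in $\mathbb{R}^n$ with respect to $A$. (2) If for every nonempty $I\subseteq\{a_0,\ldots,a_p\}$ a weighted weak witness $x_I\in\mathbb{R}^n$ with respect to $A$ is given for the subsimplex $\sigma_I$ with vertex set $I$, then the convex hull of the points $x_I$ contains a weighted strong witness for $\sigma$ with respect to $A$.
   Context: A simplex $\sigma=[a_0\ldots a_p]$ with vertices in $A$ is a set of $p+1$ distinct points $\{a_0,\ldots,a_p\}\subseteq A$; a subsimplex $\tau\le\sigma$ is a simplex whose vertex set is a nonempty subset of that of $\sigma$ (including $\sigma$ itself). Let $|\cdot|$ be the Euclidean norm. A point $x\in\mathbb{R}^n$ is a weighted weak witness for $\sigma$ with respect to $A$ if $|x-a|^2+w_a\le|x-b|^2+w_b$ whenever $a\in\{a_0,\ldots,a_p\}$ and $b\in A\setminus\{a_0,\ldots,a_p\}$. It is a weighted strong witness for $\sigma$ with respect to $A$ if it is a weighted weak witness and additionally $|x-a_0|^2+w_{a_0}=|x-a_1|^2+w_{a_1}=\cdots=|x-a_p|^2+w_{a_p}$. *)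

theory Defs
  imports "HOL-Analysis.Analysis"
begin

(* A simplex is identified with its vertex set and is purely combinatorial: the vertices are
   distinct but need not be affinely independent, unlike the library's "p simplex S".
   The equation card S = p + 1 forces S to be finite and nonempty. *)
definition simplex_in :: "(real ^ 'n) set \<Rightarrow> nat \<Rightarrow> (real ^ 'n) set \<Rightarrow> bool" where
  "simplex_in A p S \<longleftrightarrow> S \<subseteq> A \<and> card S = p + 1"

definition subsimplex :: "(real ^ 'n) set \<Rightarrow> (real ^ 'n) set \<Rightarrow> bool" where
  "subsimplex T S \<longleftrightarrow> T \<noteq> {} \<and> T \<subseteq> S"

(* The weight w is a total function; for S a subset of A only its values on A are used. *)
definition weighted_weak_witness ::
    "(real ^ 'n) set \<Rightarrow> (real ^ 'n \<Rightarrow> real) \<Rightarrow> (real ^ 'n) set \<Rightarrow> real ^ 'n \<Rightarrow> bool" where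
  "weighted_weak_witness A w S x \<longleftrightarrow>
     (\<forall>a\<in>S. \<forall>b\<in>A - S. (norm (x - a))\<^sup>2 + w a \<le> (norm (x - b))\<^sup>2 + w b)"

definition weighted_strong_witness ::
    "(real ^ 'n) set \<Rightarrow> (real ^ 'n \<Rightarrow> real) \<Rightarrow> (real ^ 'n) set \<Rightarrow> real ^ 'n \<Rightarrow> bool" where
  "weighted_strong_witness A w S x \<longleftrightarrow>
     weighted_weak_witness A w S x \<and>
     (\<forall>a\<in>S. \<forall>b\<in>S. (norm (x - a))\<^sup>2 + w a = (norm (x - b))\<^sup>2 + w b)"

end

(* Write f_a(y) = |y - a|^2 + w_a. Every difference f_a - f_b is affine, and y is a strong witness
   for sigma iff f_a(y) <= f_b(y) for all a in sigma, b in A. By compactness of the hull K of the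
   points x_I it is enough to solve finitely many of these inequalities in K. If this were
   impossible, LP duality would give a nonnegative combination of the f_a - f_b that is positive
   on K. Collect it as sum_d m_d f_d, with sum_d m_d = 0, and let I be the set of d with m_d > 0,
   a subset of sigma. At x_I the functions f_d with m_d > 0 lie below those with m_d <= 0,
   so the combination is nonpositive there, a contradiction. *)

theory Submission
  imports Defs
begin

text \<open>The two affine functions map \<open>K\<close> to a compact convex subset of the plane
  that misses the closed quadrant of nonpositive pairs. The normal of a strictly separating line
  supplies \<open>s\<close> and \<open>t\<close>.\<close>

lemma affine_alternative_two:
  fixes K :: "'a :: euclidean_space set"
  assumes "compact K" "convex K"
    and pos: "\<And>y. y \<in> K \<Longrightarrow> u \<bullet> y + v \<le> 0 \<Longrightarrow> 0 < u' \<bullet> y + v'"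
  obtains s t :: real where "0 \<le> s" "0 \<le> t"
    "\<And>y. y \<in> K \<Longrightarrow> 0 < s * (u \<bullet> y + v) + t * (u' \<bullet> y + v')"
proof (cases "K = {}")
  case True
  then show ?thesis using that[of 0 0] by simp
next
  case False
  define f where "f y = (u \<bullet> y, u' \<bullet> y)" for y
  define S where "S = (\<lambda>z. (v, v') + z) ` f ` K"
  define Q :: "(real \<times> real) set" where "Q = {..0} \<times> {..0}"
  have "linear f"
    unfolding f_def by (intro linearI) (auto simp: inner_add_right)
  then have "convex S"
    unfolding S_def using \<open>convex K\<close> by (intro convex_translation convex_linear_image)
  moreover have "compact S"
    unfolding S_def f_def using \<open>compact K\<close>
    by (intro compact_translation compact_continuous_image continuous_intros)
  moreover have "convex Q" "closed Q"
    unfolding Q_def by (auto intro!: convex_Times closed_Times)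
  moreover have "Q \<inter> S = {}"
    unfolding S_def Q_def f_def using pos by (force simp: add.commute)
  moreover have "S \<noteq> {}"
    unfolding S_def using False by simp
  ultimately obtain c b where
    Q: "\<And>z. z \<in> Q \<Longrightarrow> c \<bullet> z < b" and S: "\<And>z. z \<in> S \<Longrightarrow> b < c \<bullet> z"
    using separating_hyperplane_closed_compact[of Q S] by blast
  obtain s t where c: "c = (s, t)" by fastforce
  \<comment> \<open>The quadrant contains the origin, which fixes the sign of the separating
    constant.\<close>
  have b: "0 < b"
    using Q[of "(0, 0)"] by (simp add: Q_def c)
  \<comment> \<open>For negative \<open>s\<close> the point \<open>(b / s, 0)\<close> would lie in
    \<open>Q\<close> and on the separating line itself; likewise for \<open>t\<close>.\<close>
  have "0 \<le> s"
  proof (rule ccontr)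
    assume "\<not> 0 \<le> s"
    with b Q[of "(b / s, 0)"] show False
      by (simp add: Q_def c divide_nonneg_neg divide_le_0_iff)
  qed
  moreover have "0 \<le> t"
  proof (rule ccontr)
    assume "\<not> 0 \<le> t"
    with b Q[of "(0, b / t)"] show False
      by (simp add: Q_def c divide_nonneg_neg divide_le_0_iff)
  qed
  moreover have "0 < s * (u \<bullet> y + v) + t * (u' \<bullet> y + v')" if "y \<in> K" for y
  proof -
    have "(v, v') + f y \<in> S"
      unfolding S_def using that by blast
    from S[OF this] b show ?thesis by (simp add: f_def c add.commute)
  qed
  ultimately show ?thesis by (rule that)
qed

text \<open>Induction on \<open>F\<close>, with \<open>K\<close> varying: the hypothesis for the
  part of \<open>K\<close> where function \<open>j\<close> is nonpositive merges the other functions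
  into one affine function, and the case of two functions then applies on all of
  \<open>K\<close>.\<close>

lemma affine_alternative:
  fixes K :: "'a :: euclidean_space set" and u :: "'k \<Rightarrow> 'a" and v :: "'k \<Rightarrow> real"
  assumes "finite F" "compact K" "convex K"
    and "\<And>y. y \<in> K \<Longrightarrow> \<exists>k\<in>F. 0 < u k \<bullet> y + v k"
  shows "\<exists>c. (\<forall>k\<in>F. 0 \<le> c k) \<and> (\<forall>y\<in>K. 0 < (\<Sum>k\<in>F. c k * (u k \<bullet> y + v k)))"
  using assms
proof (induction F arbitrary: K rule: finite_induct)
  case empty
  then show ?case by auto
next
  case (insert j F)
  let ?K = "K \<inter> {y. u j \<bullet> y \<le> - v j}"
  have "compact ?K" "convex ?K"
    using insert.prems by (auto intro: compact_Int_closed closed_halfspace_le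
        convex_Int convex_halfspace_le)
  moreover have "\<exists>k\<in>F. 0 < u k \<bullet> y + v k" if "y \<in> ?K" for y
    using insert.prems(3)[of y] that by auto
  ultimately obtain c where c: "\<And>k. k \<in> F \<Longrightarrow> 0 \<le> c k"
    "\<And>y. y \<in> ?K \<Longrightarrow> 0 < (\<Sum>k\<in>F. c k * (u k \<bullet> y + v k))"
    using insert.IH[of ?K] by blast
  have sum_eq: "(\<Sum>k\<in>F. c k * (u k \<bullet> y + v k)) =
      (\<Sum>k\<in>F. c k *\<^sub>R u k) \<bullet> y + (\<Sum>k\<in>F. c k * v k)" for y
    by (simp add: inner_sum_left distrib_left sum.distrib)
  obtain s t where st: "0 \<le> s" "0 \<le> t" and
    pos: "\<And>y. y \<in> K \<Longrightarrow>
      0 < s * (u j \<bullet> y + v j) + t * (\<Sum>k\<in>F. c k * (u k \<bullet> y + v k))"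
  proof (rule affine_alternative_two[OF insert.prems(1,2), of "u j" "v j"
        "\<Sum>k\<in>F. c k *\<^sub>R u k" "\<Sum>k\<in>F. c k * v k"])
    show "0 < (\<Sum>k\<in>F. c k *\<^sub>R u k) \<bullet> y + (\<Sum>k\<in>F. c k * v k)"
      if "y \<in> K" "u j \<bullet> y + v j \<le> 0" for y
      using c(2)[of y] that by (simp add: sum_eq)
  qed (simp add: sum_eq)
  let ?c = "\<lambda>k. if k = j then s else t * c k"
  have "(\<Sum>k\<in>insert j F. ?c k * (u k \<bullet> y + v k)) =
      s * (u j \<bullet> y + v j) + t * (\<Sum>k\<in>F. c k * (u k \<bullet> y + v k))" for y
  proof -
    have "(\<Sum>k\<in>F. ?c k * (u k \<bullet> y + v k)) = (\<Sum>k\<in>F. t * (c k * (u k \<bullet> y + v k)))"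
      using insert.hyps by (intro sum.cong) (auto simp: mult.assoc)
    then show ?thesis
      using insert.hyps by (simp add: sum_distrib_left)
  qed
  then show ?case
    using st c(1) pos by (intro exI[of _ ?c]) auto
qed

text \<open>Regards the pairs in \<open>F\<close> as weighted edges: the net coefficient of
  \<open>h d\<close> is the weight leaving \<open>d\<close> minus the weight entering it.\<close>

lemma sum_differences_collect:
  fixes c :: "'a \<times> 'a \<Rightarrow> real" and h :: "'a \<Rightarrow> real"
  assumes "finite F" "finite B" "fst ` F \<subseteq> B" "snd ` F \<subseteq> B"
  shows "(\<Sum>k\<in>F. c k * (h (fst k) - h (snd k))) =
    (\<Sum>d\<in>B. ((\<Sum>k\<in>{k \<in> F. fst k = d}. c k) - (\<Sum>k\<in>{k \<in> F. snd k = d}. c k)) * h d)"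
proof -
  have "(\<Sum>d\<in>B. (\<Sum>k\<in>{k \<in> F. q k = d}. c k) * h d) = (\<Sum>k\<in>F. c k * h (q k))"
    if "q ` F \<subseteq> B" for q
  proof -
    have "(\<Sum>d\<in>B. (\<Sum>k\<in>{k \<in> F. q k = d}. c k) * h d) =
        (\<Sum>d\<in>B. \<Sum>k\<in>{k \<in> F. q k = d}. c k * h (q k))"
      by (auto simp: sum_distrib_right intro!: sum.cong)
    also have "\<dots> = (\<Sum>k\<in>F. c k * h (q k))"
      using assms(1,2) that by (rule sum.group)
    finally show ?thesis .
  qed
  from this[OF assms(3)] this[OF assms(4)] show ?thesis
    by (simp add: left_diff_distrib right_diff_distrib sum_subtractf)
qed

text \<open>Rules out the positive combination produced by duality. The choice of \<open>I\<close>
  depends on \<open>c\<close>: it is the set of points with positive net coefficient, or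
  \<open>\<sigma>\<close> if there are none.\<close>

lemma weak_witnesses_nonpos_combination:
  assumes "\<sigma> \<subseteq> A" "\<sigma> \<noteq> {}"
    and x: "\<And>I. subsimplex I \<sigma> \<Longrightarrow> weighted_weak_witness A w I (x I)"
    and F: "finite F" "F \<subseteq> \<sigma> \<times> A" and c: "\<And>k. k \<in> F \<Longrightarrow> 0 \<le> c k"
  shows "\<exists>I. subsimplex I \<sigma> \<and>
    (\<Sum>k\<in>F. c k * (((norm (x I - fst k))\<^sup>2 + w (fst k)) -
                     ((norm (x I - snd k))\<^sup>2 + w (snd k)))) \<le> 0"
proof -
  define g where "g y d = (norm (y - d))\<^sup>2 + w d" for y d
  define B where "B = fst ` F \<union> snd ` F"
  define m where
    "m d = (\<Sum>k\<in>{k \<in> F. fst k = d}. c k) - (\<Sum>k\<in>{k \<in> F. snd k = d}. c k)" for d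
  have "finite B" "B \<subseteq> A"
    using F assms(1) by (auto simp: B_def)
  have collect: "(\<Sum>k\<in>F. c k * (h (fst k) - h (snd k))) = (\<Sum>d\<in>B. m d * h d)" for h
    unfolding m_def using F(1) by (intro sum_differences_collect) (auto simp: B_def)
  \<comment> \<open>For a constant \<open>h\<close> every difference vanishes.\<close>
  have m_sum: "(\<Sum>d\<in>B. m d) = 0"
    using collect[of "\<lambda>_. 1"] by simp
  define P where "P = {d \<in> B. 0 < m d}"
  have "P \<subseteq> \<sigma>"
  proof
    fix d assume "d \<in> P"
    then have "0 < m d" by (simp add: P_def)
    \<comment> \<open>The subtracted weight is nonnegative, so a positive \<open>m d\<close> forces
      some pair of \<open>F\<close> to have first component \<open>d\<close>, and first components
      lie in \<open>\<sigma>\<close>.\<close>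
    moreover have "0 \<le> (\<Sum>k\<in>{k \<in> F. snd k = d}. c k)"
      using c by (intro sum_nonneg) auto
    ultimately have "{k \<in> F. fst k = d} \<noteq> {}"
      unfolding m_def by (auto simp del: Collect_empty_eq)
    then show "d \<in> \<sigma>" using F(2) by auto
  qed
  have "\<exists>I. subsimplex I \<sigma> \<and> (\<Sum>d\<in>B. m d * g (x I) d) \<le> 0"
  proof (cases "P = {}")
    case True
    then have "\<forall>d\<in>B. 0 \<le> - m d"
      by (auto simp: P_def not_less)
    then have "\<forall>d\<in>B. m d = 0"
      using m_sum \<open>finite B\<close> sum_nonneg_eq_0_iff[of B "\<lambda>d. - m d"] by (simp add: sum_negf)
    then show ?thesis
      using assms(2) by (intro exI[of _ \<sigma>]) (simp add: subsimplex_def)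
  next
    case False
    then have P: "subsimplex P \<sigma>"
      using \<open>P \<subseteq> \<sigma>\<close> by (simp add: subsimplex_def)
    \<comment> \<open>A threshold between the values on \<open>P\<close> and those on
      \<open>B - P\<close>, which exists because \<open>x P\<close> is a weak witness for
      \<open>P\<close>. Since the \<open>m d\<close> sum to zero, replacing every value by
      \<open>t\<close> yields total 0.\<close>
    define t where "t = Max (g (x P) ` P)"
    have "finite P" using \<open>finite B\<close> by (simp add: P_def)
    have "g (x P) d \<le> t" if "d \<in> P" for d
      unfolding t_def using \<open>finite P\<close> that by simp
    moreover have "t \<le> g (x P) d" if "d \<in> B - P" for d
      unfolding t_def using \<open>finite P\<close> False that x[OF P] \<open>B \<subseteq> A\<close>
      by (auto simp: weighted_weak_witness_def g_def)
    ultimately have "m d * g (x P) d \<le> m d * t" if "d \<in> B" for d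
      using that by (cases "d \<in> P") (auto simp: P_def intro: mult_left_mono mult_left_mono_neg)
    then have "(\<Sum>d\<in>B. m d * g (x P) d) \<le> (\<Sum>d\<in>B. m d * t)"
      by (rule sum_mono)
    also have "\<dots> = 0"
      by (simp add: m_sum flip: sum_distrib_right)
    finally show ?thesis using P by blast
  qed
  then show ?thesis
    unfolding collect[symmetric] by (simp add: g_def)
qed

text \<open>Within \<open>\<sigma>\<close> an equality is a pair of opposite inequalities, so being
  a strong witness becomes a system of inequalities only.\<close>

lemma weighted_strong_witness_iff:
  assumes "\<sigma> \<subseteq> A"
  shows "weighted_strong_witness A w \<sigma> y \<longleftrightarrow>
    (\<forall>a\<in>\<sigma>. \<forall>b\<in>A. (norm (y - a))\<^sup>2 + w a \<le> (norm (y - b))\<^sup>2 + w b)"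
proof
  assume "weighted_strong_witness A w \<sigma> y"
  then show "\<forall>a\<in>\<sigma>. \<forall>b\<in>A. (norm (y - a))\<^sup>2 + w a \<le> (norm (y - b))\<^sup>2 + w b"
    unfolding weighted_strong_witness_def weighted_weak_witness_def
    by (metis DiffI order_refl)
next
  assume "\<forall>a\<in>\<sigma>. \<forall>b\<in>A. (norm (y - a))\<^sup>2 + w a \<le> (norm (y - b))\<^sup>2 + w b"
  then show "weighted_strong_witness A w \<sigma> y"
    unfolding weighted_strong_witness_def weighted_weak_witness_def
    using assms by (auto intro: antisym)
qed

lemma weighted_strong_witness_imp_weak_subsimplex:
  assumes "weighted_strong_witness A w \<sigma> y" "\<sigma> \<subseteq> A" "subsimplex \<tau> \<sigma>"
  shows "weighted_weak_witness A w \<tau> y"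
  using assms by (auto simp: weighted_strong_witness_iff weighted_weak_witness_def subsimplex_def)

text \<open>The terms quadratic in \<open>y\<close> cancel, so each inequality of that system
  defines a closed halfspace or a trivial condition.\<close>

lemma power_distance_diff:
  fixes y a b :: "'a :: real_inner"
  shows "((norm (y - a))\<^sup>2 + w a) - ((norm (y - b))\<^sup>2 + w b) =
    (2 *\<^sub>R (b - a)) \<bullet> y + (a \<bullet> a + w a - b \<bullet> b - w b)"
  by (simp add: power2_norm_eq_inner inner_diff_left inner_diff_right inner_commute)

lemma strong_witness_in_hull:
  fixes A :: "(real ^ 'n) set"
  assumes "\<sigma> \<subseteq> A" "\<sigma> \<noteq> {}" "finite \<sigma>"
    and x: "\<And>I. subsimplex I \<sigma> \<Longrightarrow> weighted_weak_witness A w I (x I)"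
  shows "\<exists>y \<in> convex hull (x ` {I. subsimplex I \<sigma>}). weighted_strong_witness A w \<sigma> y"
proof -
  define K where "K = convex hull (x ` {I. subsimplex I \<sigma>})"
  define u :: "(real ^ 'n) \<times> (real ^ 'n) \<Rightarrow> real ^ 'n"
    where "u k = 2 *\<^sub>R (snd k - fst k)" for k
  define v where "v k = fst k \<bullet> fst k + w (fst k) - snd k \<bullet> snd k - w (snd k)" for k
  define H where "H k = {y. u k \<bullet> y \<le> - v k}" for k
  have diff: "((norm (y - fst k))\<^sup>2 + w (fst k)) - ((norm (y - snd k))\<^sup>2 + w (snd k)) =
      u k \<bullet> y + v k" for y k
    by (simp only: power_distance_diff u_def v_def)
  \<comment> \<open>A finite \<open>\<sigma>\<close> has finitely many subsimplices, which makes the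
    hull \<open>K\<close> compact.\<close>
  have "finite {I. subsimplex I \<sigma>}"
    by (rule finite_subset[of _ "Pow \<sigma>"]) (use assms(3) in \<open>auto simp: subsimplex_def\<close>)
  then have "compact K" "convex K"
    by (simp_all add: K_def finite_imp_compact_convex_hull)
  have "K \<inter> \<Inter> (H ` (\<sigma> \<times> A)) \<noteq> {}"
  \<comment> \<open>\<open>A\<close> may be infinite; the finite intersection property leaves only
    finitely many pairs \<open>F\<close> to treat.\<close>
  proof (rule compact_imp_fip_image[OF \<open>compact K\<close>])
    show "closed (H k)" for k
      unfolding H_def by (rule closed_halfspace_le)
    fix F assume F: "finite F" "F \<subseteq> \<sigma> \<times> A"
    show "K \<inter> \<Inter> (H ` F) \<noteq> {}"
    proof
      assume empty: "K \<inter> \<Inter> (H ` F) = {}"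
      have "\<exists>k\<in>F. 0 < u k \<bullet> y + v k" if "y \<in> K" for y
        using empty that by (force simp: H_def)
      then have "\<exists>c. (\<forall>k\<in>F. 0 \<le> c k) \<and> (\<forall>y\<in>K. 0 < (\<Sum>k\<in>F. c k * (u k \<bullet> y + v k)))"
        by (rule affine_alternative[OF F(1) \<open>compact K\<close> \<open>convex K\<close>])
      then obtain c where c: "\<forall>k\<in>F. 0 \<le> c k"
        and pos: "\<forall>y\<in>K. 0 < (\<Sum>k\<in>F. c k * (u k \<bullet> y + v k))"
        by blast
      have "\<exists>I. subsimplex I \<sigma> \<and> (\<Sum>k\<in>F. c k * (u k \<bullet> x I + v k)) \<le> 0"
        unfolding diff[symmetric]
        by (rule weak_witnesses_nonpos_combination[OF assms(1,2) x F]) (use c in auto)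
      then obtain I where I: "subsimplex I \<sigma>"
        "(\<Sum>k\<in>F. c k * (u k \<bullet> x I + v k)) \<le> 0"
        by blast
      have "x I \<in> K"
        unfolding K_def using I(1) by (intro hull_inc) auto
      with pos I(2) show False by force
    qed
  qed
  then obtain y where "y \<in> K" and y: "\<And>k. k \<in> \<sigma> \<times> A \<Longrightarrow> u k \<bullet> y + v k \<le> 0"
    by (force simp: H_def)
  have "(norm (y - a))\<^sup>2 + w a \<le> (norm (y - b))\<^sup>2 + w b" if "a \<in> \<sigma>" "b \<in> A" for a b
    using y[of "(a, b)"] that by (simp flip: diff)
  then show ?thesis
    using \<open>y \<in> K\<close> assms(1) by (auto simp: K_def weighted_strong_witness_iff)
qed

theorem mainTheorem6:
  fixes A :: "(real ^ 'n) set" and w :: "real ^ 'n \<Rightarrow> real"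
    and \<sigma> :: "(real ^ 'n) set" and p :: nat
  assumes "simplex_in A p \<sigma>"
  shows "((\<exists>x. weighted_strong_witness A w \<sigma> x) \<longleftrightarrow>
            (\<forall>\<tau>. subsimplex \<tau> \<sigma> \<longrightarrow> (\<exists>x. weighted_weak_witness A w \<tau> x))) \<and>
         (\<forall>x :: (real ^ 'n) set \<Rightarrow> real ^ 'n.
            (\<forall>I. subsimplex I \<sigma> \<longrightarrow> weighted_weak_witness A w I (x I)) \<longrightarrow>
            (\<exists>y \<in> convex hull (x ` {I. subsimplex I \<sigma>}). weighted_strong_witness A w \<sigma> y))"
proof -
  have \<sigma>: "\<sigma> \<subseteq> A" "\<sigma> \<noteq> {}" "finite \<sigma>"
    using assms by (auto simp: simplex_in_def intro: card_ge_0_finite)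
  note hull = strong_witness_in_hull[OF \<sigma>]
  \<comment> \<open>Choosing one weak witness for each subsimplex gives a family \<open>x\<close> to
    which the hull statement applies.\<close>
  have "\<exists>y. weighted_strong_witness A w \<sigma> y"
    if "\<forall>\<tau>. subsimplex \<tau> \<sigma> \<longrightarrow> (\<exists>x. weighted_weak_witness A w \<tau> x)"
    using that hull[of w] by metis
  then show ?thesis
    using hull weighted_strong_witness_imp_weak_subsimplex[OF _ \<sigma>(1)] by blast
qed

end
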